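(* Let $E_1,E_2$ be real Banach spaces, let $C\subset E_1$ and $Q\subset E_2$ be nonempty, closed and convex, let $A:E_1\to E_2$ be a bounded linear operator, and let $f:E_1\times E_1\to\mathbb{R}$ and $g:E_2\times E_2\to\mathbb{R}$ be bifunctions. Let $N$ be a normed space, let $M\subset N$ be a closed ball centered at $p^*$ with positive radius, and let $\tilde f:M\times E_1\times E_1\to\mathbb{R}$ and $\tilde g:M\times E_2\times E_2\to\mathbb{R}$ be functions with $\tilde f(p^*,\cdot,\cdot)=f$ and $\tilde g(p^*,\cdot,\cdot)=g$. Then the split equilibrium problem $SEP(f,g,C,Q)$ is LP well-posed by perturbations if and only if its solution set $S$ is nonempty and $\operatorname{diam}(S(\epsilon))\to 0$ as $\epsilon\to 0$ (where $\epsilon>0$).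
   Context: The split equilibrium problem $SEP(f,g,C,Q)$ is: find $(x^*,y^* )\in E_1\times E_2$ such that $x^*\in C$, $y^*\in Q$, $y^*=Ax^*$, $f(x^*,x)\ge 0$ for all $x\in C$, and $g(y^*,y)\ge 0$ for all $y\in Q$. Its solution set is denoted by $S$. The space $E_1\times E_2$ carries a standard product norm (e.g. $\|(x,y)\|=\|x\|+\|y\|$). Generalized approximating sequence: let $\{p_n\}\subset M$ with $p_n\to p^*$. A sequence $\{(x_n,y_n)\}$ in $E_1\times E_2$ is a generalized approximating sequence corresponding to $\{p_n\}$ for $SEP(f,g,C,Q)$ if there exists a sequence of positive numbers $\epsilon_n\to 0$ such that, for every $n$, $d(x_n,C)\le\epsilon_n$, $d(y_n,Q)\le\epsilon_n$, $\|y_n-Ax_n\|\le\epsilon_n$, $\tilde f(p_n,x_n,x)\ge-\epsilon_n$ for all $x\in C$, and $\tilde g(p_n,y_n,y)\ge-\epsilon_n$ for all $y\in Q$. Here $d(a,B)=\inf_{b\in B}\|a-b\|$. LP (Levitin-Polyak) well-posedness by perturbations: $SEP(f,g,C,Q)$ is LP well-posed by perturbations if $S$ is a singleton and, for any $\{p_n\}\subset M$ with $p_n\to p^*$, every generalized approximating sequence corresponding to $\{p_n\}$ converges to the unique solution. Approximate solution set: for $\epsilon\ge 0$, $S(\epsilon)$ is the set of all $(z,w)\in E_1\times E_2$ for which there is $p\in M$ with $\|p-p^*\|\le\epsilon$ such that $d(z,C)\le\epsilon$, $d(w,Q)\le\epsilon$, $\|w-Az\|\le\epsilon$, $\tilde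 f(p,z,x)\ge-\epsilon$ for all $x\in C$, and $\tilde g(p,w,y)\ge-\epsilon$ for all $y\in Q$. The diameter of a set $B$ is $\operatorname{diam}(B)=\sup\{\|u-v\|:u,v\in B\}$. *)

theory Defs
  imports "HOL-Analysis.Analysis"
begin

definition SEP_solutions ::
  "('a::real_normed_vector \<Rightarrow> 'a \<Rightarrow> real) \<Rightarrow> ('b::real_normed_vector \<Rightarrow> 'b \<Rightarrow> real) \<Rightarrow>
   'a set \<Rightarrow> 'b set \<Rightarrow> ('a \<Rightarrow> 'b) \<Rightarrow> ('a \<times> 'b) set"
where
  "SEP_solutions f g C Q A =
    {(x, y). x \<in> C \<and> y \<in> Q \<and> y = A x \<and> (\<forall>u\<in>C. f x u \<ge> 0) \<and> (\<forall>v\<in>Q. g y v \<ge> 0)}"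

text \<open>
  In the following, \<open>ft\<close> and \<open>gt\<close> are the perturbed bifunctions; they are total functions, but only
  their values at parameters in \<open>M\<close> are ever used.
\<close>

definition generalized_approximating_sequence ::
  "('n::real_normed_vector \<Rightarrow> 'a::real_normed_vector \<Rightarrow> 'a \<Rightarrow> real) \<Rightarrow>
   ('n \<Rightarrow> 'b::real_normed_vector \<Rightarrow> 'b \<Rightarrow> real) \<Rightarrow>
   'a set \<Rightarrow> 'b set \<Rightarrow> ('a \<Rightarrow> 'b) \<Rightarrow> (nat \<Rightarrow> 'n) \<Rightarrow> (nat \<Rightarrow> 'a \<times> 'b) \<Rightarrow> bool"
where
  "generalized_approximating_sequence ft gt C Q A p z \<longleftrightarrow>
    (\<exists>\<epsilon> :: nat \<Rightarrow> real. (\<forall>n. \<epsilon> n > 0) \<and> \<epsilon> \<longlonglongrightarrow> 0 \<and>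
      (\<forall>n. infdist (fst (z n)) C \<le> \<epsilon> n \<and>
           infdist (snd (z n)) Q \<le> \<epsilon> n \<and>
           norm (snd (z n) - A (fst (z n))) \<le> \<epsilon> n \<and>
           (\<forall>u\<in>C. ft (p n) (fst (z n)) u \<ge> - \<epsilon> n) \<and>
           (\<forall>v\<in>Q. gt (p n) (snd (z n)) v \<ge> - \<epsilon> n)))"

definition LP_well_posed_by_perturbations ::
  "('a::real_normed_vector \<Rightarrow> 'a \<Rightarrow> real) \<Rightarrow> ('b::real_normed_vector \<Rightarrow> 'b \<Rightarrow> real) \<Rightarrow>
   'a set \<Rightarrow> 'b set \<Rightarrow> ('a \<Rightarrow> 'b) \<Rightarrow> 'n::real_normed_vector set \<Rightarrow> 'n \<Rightarrow>
   ('n \<Rightarrow> 'a \<Rightarrow> 'a \<Rightarrow> real) \<Rightarrow> ('n \<Rightarrow> 'b \<Rightarrow> 'b \<Rightarrow> real) \<Rightarrow> bool"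
where
  "LP_well_posed_by_perturbations f g C Q A M pstar ft gt \<longleftrightarrow>
    (\<exists>s. SEP_solutions f g C Q A = {s} \<and>
      (\<forall>p z. (\<forall>n. p n \<in> M) \<and> p \<longlonglongrightarrow> pstar \<and>
             generalized_approximating_sequence ft gt C Q A p z \<longrightarrow> z \<longlonglongrightarrow> s))"

definition approx_solutions ::
  "'a::real_normed_vector set \<Rightarrow> 'b::real_normed_vector set \<Rightarrow> ('a \<Rightarrow> 'b) \<Rightarrow>
   'n::real_normed_vector set \<Rightarrow> 'n \<Rightarrow>
   ('n \<Rightarrow> 'a \<Rightarrow> 'a \<Rightarrow> real) \<Rightarrow> ('n \<Rightarrow> 'b \<Rightarrow> 'b \<Rightarrow> real) \<Rightarrow> real \<Rightarrow> ('a \<times> 'b) set"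
where
  "approx_solutions C Q A M pstar ft gt \<epsilon> =
    {(z, w). \<exists>p\<in>M. norm (p - pstar) \<le> \<epsilon> \<and>
       infdist z C \<le> \<epsilon> \<and> infdist w Q \<le> \<epsilon> \<and> norm (w - A z) \<le> \<epsilon> \<and>
       (\<forall>u\<in>C. ft p z u \<ge> - \<epsilon>) \<and> (\<forall>v\<in>Q. gt p w v \<ge> - \<epsilon>)}"

text \<open>
  The approximate solution sets may be unbounded, and the real-valued \<^const>\<open>diameter\<close> has no
  meaningful value on unbounded sets; hence the supremum is taken in the extended nonnegative reals.
  On pairs the norm is the Euclidean product norm of the library,
  \<open>norm (x, y) = sqrt ((norm x)\<^sup>2 + (norm y)\<^sup>2)\<close>.
\<close>

definition ediam :: "'c::real_normed_vector set \<Rightarrow> ennreal" where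
  "ediam B = (SUP (u, v) \<in> B \<times> B. ennreal (norm (u - v)))"

end

theory Submission
  imports Defs
begin

text \<open>
  Up to the choice of the tolerances, a generalized approximating sequence is a sequence of points
  \<open>z n\<close> in \<open>S(\<delta> n)\<close> with \<open>\<delta> n > 0\<close> and \<open>\<delta> n \<rightarrow> 0\<close>. Hence well-posedness says that the sets
  \<open>S(\<epsilon>)\<close>, which decrease with \<open>\<epsilon>\<close> and all contain \<open>S\<close>, shrink to the unique solution.
\<close>

lemma norm_le_ediam:
  assumes "u \<in> B" and "v \<in> B"
  shows "ennreal (norm (u - v)) \<le> ediam B"
  unfolding ediam_def using assms by (intro SUP_upper2[of "(u, v)"]) auto

text \<open>Any two points of \<open>B\<close> are compared through the common centre
  \<open>s\<close>, which need not lie in \<open>B\<close>.\<close>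

lemma ediam_le_double_radius:
  assumes "\<And>u. u \<in> B \<Longrightarrow> norm (u - s) \<le> e"
  shows "ediam B \<le> ennreal (2 * e)"
proof -
  have "norm (u - v) \<le> 2 * e" if "u \<in> B" "v \<in> B" for u v
    using norm_triangle_ineq4[of "u - s" "v - s"] assms[OF that(1)] assms[OF that(2)] by simp
  then show ?thesis
    unfolding ediam_def by (intro SUP_least) (auto intro!: ennreal_leI)
qed

text \<open>The same parameter remains a witness, since every bound weakens as the tolerance grows.
  Thus control of one approximate solution set controls all those with smaller tolerance.\<close>

lemma approx_solutions_mono:
  assumes "\<delta> \<le> \<epsilon>"
  shows "approx_solutions C Q A M pstar ft gt \<delta> \<subseteq> approx_solutions C Q A M pstar ft gt \<epsilon>"
proof -
  have "- \<epsilon> \<le> - \<delta>"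
    using assms by simp
  then show ?thesis
    unfolding approx_solutions_def using assms by (auto; meson order_trans)
qed

text \<open>The unperturbed parameter \<open>pstar\<close> is the witness: there the perturbed
  bifunctions are \<open>f\<close> and \<open>g\<close>, and all distances vanish.\<close>

lemma SEP_solutions_subset_approx_solutions:
  assumes "pstar \<in> M" and "\<epsilon> \<ge> 0"
    and "\<And>x u. ft pstar x u = f x u" and "\<And>y v. gt pstar y v = g y v"
  shows "SEP_solutions f g C Q A \<subseteq> approx_solutions C Q A M pstar ft gt \<epsilon>"
proof (clarsimp simp: SEP_solutions_def approx_solutions_def, intro bexI[of _ pstar] conjI ballI)
  fix x u assume "\<forall>u\<in>C. 0 \<le> f x u" "u \<in> C"
  then have "0 \<le> f x u" by blast
  then show "- \<epsilon> \<le> ft pstar x u" using assms by simp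
next
  fix x v assume "\<forall>v\<in>Q. 0 \<le> g (A x) v" "v \<in> Q"
  then have "0 \<le> g (A x) v" by blast
  then show "- \<epsilon> \<le> gt pstar (A x) v" using assms by simp
qed (use assms in auto)

text \<open>The two notions differ in one point: an approximating sequence prescribes no rate for
  \<open>p n\<close> to reach \<open>pstar\<close>, whereas an approximate solution bounds that
  distance by its tolerance. The tolerance therefore has to be enlarged.\<close>

lemma generalized_approximating_sequence_imp_approx_solutions:
  assumes p: "\<And>n. p n \<in> M" "p \<longlonglongrightarrow> pstar"
    and "generalized_approximating_sequence ft gt C Q A p z"
  obtains \<delta> :: "nat \<Rightarrow> real" where "\<And>n. \<delta> n > 0" "\<delta> \<longlonglongrightarrow> 0"
    "\<And>n. z n \<in> approx_solutions C Q A M pstar ft gt (\<delta> n)"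
proof -
  obtain \<epsilon> where \<epsilon>: "\<And>n. \<epsilon> n > (0::real)" "\<epsilon> \<longlonglongrightarrow> 0"
    and z: "\<And>n. infdist (fst (z n)) C \<le> \<epsilon> n \<and> infdist (snd (z n)) Q \<le> \<epsilon> n \<and>
           norm (snd (z n) - A (fst (z n))) \<le> \<epsilon> n \<and>
           (\<forall>u\<in>C. ft (p n) (fst (z n)) u \<ge> - \<epsilon> n) \<and>
           (\<forall>v\<in>Q. gt (p n) (snd (z n)) v \<ge> - \<epsilon> n)"
    using assms(3) unfolding generalized_approximating_sequence_def by blast
  \<comment> \<open>The sum dominates both the given tolerance and the parameter distance, and still
    tends to 0.\<close>
  define \<delta> where "\<delta> = (\<lambda>n. \<epsilon> n + norm (p n - pstar))"
  have le: "\<epsilon> n \<le> \<delta> n" "- \<delta> n \<le> - \<epsilon> n" "norm (p n - pstar) \<le> \<delta> n" for n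
    using \<epsilon>(1)[of n] by (auto simp: \<delta>_def)
  show ?thesis
  proof
    show "\<delta> n > 0" for n
      using \<epsilon>(1)[of n] le(1)[of n] by linarith
    have "(\<lambda>n. norm (p n - pstar)) \<longlonglongrightarrow> 0"
      using p(2) by (simp add: LIM_zero tendsto_norm_zero)
    then show "\<delta> \<longlonglongrightarrow> 0"
      unfolding \<delta>_def using tendsto_add[OF \<epsilon>(2)] by fastforce
    show "z n \<in> approx_solutions C Q A M pstar ft gt (\<delta> n)" for n
      using z[of n] le[of n] p(1)[of n] unfolding approx_solutions_def case_prod_unfold
      by (auto intro!: bexI[of _ "p n"] intro: order_trans)
  qed
qed

text \<open>Choosing a witnessing parameter for each \<open>n\<close> suffices:
  \<open>\<delta>\<close> itself serves as the tolerance sequence, and it also forces the parameters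
  to converge.\<close>

lemma approx_solutions_imp_generalized_approximating_sequence:
  assumes \<delta>: "\<And>n. \<delta> n > (0::real)" "\<delta> \<longlonglongrightarrow> 0"
    and "\<And>n. z n \<in> approx_solutions C Q A M pstar ft gt (\<delta> n)"
  obtains p where "\<And>n. p n \<in> M" "p \<longlonglongrightarrow> pstar"
    "generalized_approximating_sequence ft gt C Q A p z"
proof -
  have "\<forall>n. \<exists>q. q \<in> M \<and> norm (q - pstar) \<le> \<delta> n \<and>
      infdist (fst (z n)) C \<le> \<delta> n \<and> infdist (snd (z n)) Q \<le> \<delta> n \<and>
      norm (snd (z n) - A (fst (z n))) \<le> \<delta> n \<and>
      (\<forall>u\<in>C. ft q (fst (z n)) u \<ge> - \<delta> n) \<and> (\<forall>v\<in>Q. gt q (snd (z n)) v \<ge> - \<delta> n)"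
    using assms(3) unfolding approx_solutions_def case_prod_unfold by blast
  then obtain p where p: "\<And>n. p n \<in> M \<and> norm (p n - pstar) \<le> \<delta> n \<and>
      infdist (fst (z n)) C \<le> \<delta> n \<and> infdist (snd (z n)) Q \<le> \<delta> n \<and>
      norm (snd (z n) - A (fst (z n))) \<le> \<delta> n \<and>
      (\<forall>u\<in>C. ft (p n) (fst (z n)) u \<ge> - \<delta> n) \<and> (\<forall>v\<in>Q. gt (p n) (snd (z n)) v \<ge> - \<delta> n)"
    by metis
  show ?thesis
  proof
    show "p n \<in> M" for n
      using p by blast
    have "(\<lambda>n. p n - pstar) \<longlonglongrightarrow> 0"
      by (rule Lim_null_comparison[OF _ \<delta>(2)]) (use p in auto)
    then show "p \<longlonglongrightarrow> pstar"
      by (rule LIM_zero_cancel)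
    show "generalized_approximating_sequence ft gt C Q A p z"
      unfolding generalized_approximating_sequence_def using \<delta> p by blast
  qed
qed

lemma LP_well_posed_imp_ediam_tendsto_0:
  assumes "LP_well_posed_by_perturbations f g C Q A M pstar ft gt"
  shows "((\<lambda>\<epsilon>. ediam (approx_solutions C Q A M pstar ft gt \<epsilon>)) \<longlongrightarrow> 0) (at_right 0)"
proof -
  let ?S = "approx_solutions C Q A M pstar ft gt"
  obtain s where s: "\<And>p z. \<lbrakk>\<And>n. p n \<in> M; p \<longlonglongrightarrow> pstar;
      generalized_approximating_sequence ft gt C Q A p z\<rbrakk> \<Longrightarrow> z \<longlonglongrightarrow> s"
    using assms unfolding LP_well_posed_by_perturbations_def by blast
  \<comment> \<open>Sequential convergence becomes uniform closeness: otherwise each tolerance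
    1/(n+1) admits a point farther than \<open>e\<close> from \<open>s\<close>, and these points
    form an approximating sequence that cannot converge to \<open>s\<close>.\<close>
  have near: "\<exists>\<delta>>0. \<forall>z\<in>?S \<delta>. norm (z - s) \<le> e" if e: "e > 0" for e
  proof (rule ccontr)
    assume "\<not> ?thesis"
    then have "\<forall>n. \<exists>z. z \<in> ?S (inverse (real (Suc n))) \<and> norm (z - s) > e"
      by (metis not_le inverse_positive_iff_positive of_nat_0_less_iff zero_less_Suc)
    then obtain z where z: "\<And>n. z n \<in> ?S (inverse (real (Suc n)))" "\<And>n. norm (z n - s) > e"
      by metis
    obtain p where "\<And>n. p n \<in> M" "p \<longlonglongrightarrow> pstar"
      "generalized_approximating_sequence ft gt C Q A p z"
      using approx_solutions_imp_generalized_approximating_sequence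
        [OF _ LIMSEQ_inverse_real_of_nat z(1)] by auto
    then have "z \<longlonglongrightarrow> s"
      by (rule s)
    then obtain n where "norm (z n - s) < e"
      using LIMSEQ_D[OF _ e, of z s] by blast
    then show False
      using z(2)[of n] by simp
  qed
  show ?thesis
  proof (rule order_tendstoI)
    fix a :: ennreal assume "0 < a"
    \<comment> \<open>Since \<open>a\<close> may be infinite, a finite positive bound strictly below
      it is taken, so that real estimates apply.\<close>
    then obtain b where b: "0 < b" "b < a"
      using dense by blast
    then have "b < top"
      using less_le_trans top_greatest by blast
    then obtain e where e: "0 < e" "b = ennreal e"
      using b(1) by (cases b) auto
    \<comment> \<open>Radius \<open>e / 2\<close> gives diameter at most \<open>e\<close>, which is
      strictly below \<open>a\<close>.\<close>
    obtain \<delta> where \<delta>: "\<delta> > 0" "\<forall>z\<in>?S \<delta>. norm (z - s) \<le> e / 2"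
      using near[of "e / 2"] e(1) by auto
    have "ediam (?S \<epsilon>) < a" if "\<epsilon> < \<delta>" for \<epsilon>
    proof -
      have "?S \<epsilon> \<subseteq> ?S \<delta>"
        using that by (intro approx_solutions_mono) simp
      then have "ediam (?S \<epsilon>) \<le> ennreal (2 * (e / 2))"
        using \<delta>(2) by (intro ediam_le_double_radius[of _ s]) blast
      then show ?thesis
        using b e by simp
    qed
    then show "\<forall>\<^sub>F \<epsilon> in at_right 0. ediam (?S \<epsilon>) < a"
      using \<delta>(1) by (auto simp: eventually_at_right_field)
  qed simp
qed

text \<open>Both \<open>z n\<close> and the fixed point \<open>s\<close> lie in the approximate
  solution set for \<open>\<delta> n\<close>, so their distance is at most its diameter.\<close>

lemma ediam_tendsto_0_imp_tendsto:
  assumes lim: "((\<lambda>\<epsilon>. ediam (approx_solutions C Q A M pstar ft gt \<epsilon>)) \<longlongrightarrow> 0) (at_right 0)"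
    and \<delta>: "\<And>n. \<delta> n > 0" "\<delta> \<longlonglongrightarrow> 0"
    and z: "\<And>n. z n \<in> approx_solutions C Q A M pstar ft gt (\<delta> n)"
    and s: "\<And>n. s \<in> approx_solutions C Q A M pstar ft gt (\<delta> n)"
  shows "z \<longlonglongrightarrow> s"
proof -
  let ?S = "approx_solutions C Q A M pstar ft gt"
  \<comment> \<open>The diameter limit is one-sided, so positivity of \<open>\<delta>\<close> is
    what allows substituting this sequence.\<close>
  have "filterlim \<delta> (at_right 0) sequentially"
    using \<delta> by (intro tendsto_imp_filterlim_at_right) auto
  then have "(\<lambda>n. ediam (?S (\<delta> n))) \<longlonglongrightarrow> 0"
    by (rule filterlim_compose[OF lim])
  then have "(\<lambda>n. ennreal (norm (z n - s))) \<longlonglongrightarrow> ennreal 0"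
    unfolding ennreal_0
    by (rule tendsto_sandwich[OF _ _ tendsto_const, rotated 2]) (simp_all add: norm_le_ediam z s)
  then have "(\<lambda>n. norm (z n - s)) \<longlonglongrightarrow> 0"
    by (subst (asm) tendsto_ennreal_iff) auto
  then show ?thesis
    by (rule LIM_zero_cancel[OF tendsto_norm_zero_cancel])
qed

theorem theorem4:
  fixes C :: "'a::banach set" and Q :: "'b::banach set"
    and A :: "'a \<Rightarrow> 'b"
    and f :: "'a \<Rightarrow> 'a \<Rightarrow> real" and g :: "'b \<Rightarrow> 'b \<Rightarrow> real"
    and M :: "'n::real_normed_vector set" and pstar :: 'n and r :: real
    and ft :: "'n \<Rightarrow> 'a \<Rightarrow> 'a \<Rightarrow> real" and gt :: "'n \<Rightarrow> 'b \<Rightarrow> 'b \<Rightarrow> real"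
  assumes "C \<noteq> {}" and "closed C" and "convex C"
    and "Q \<noteq> {}" and "closed Q" and "convex Q"
    and "bounded_linear A"
    and "r > 0" and "M = cball pstar r"
    and "\<And>x u. ft pstar x u = f x u"
    and "\<And>y v. gt pstar y v = g y v"
  shows "LP_well_posed_by_perturbations f g C Q A M pstar ft gt \<longleftrightarrow>
    SEP_solutions f g C Q A \<noteq> {} \<and>
    ((\<lambda>\<epsilon>. ediam (approx_solutions C Q A M pstar ft gt \<epsilon>)) \<longlongrightarrow> 0) (at_right 0)"
proof (intro iffI conjI)
  let ?S = "approx_solutions C Q A M pstar ft gt"
  assume wp: "LP_well_posed_by_perturbations f g C Q A M pstar ft gt"
  then show "SEP_solutions f g C Q A \<noteq> {}"
    unfolding LP_well_posed_by_perturbations_def by blast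
  show "((\<lambda>\<epsilon>. ediam (?S \<epsilon>)) \<longlongrightarrow> 0) (at_right 0)"
    using wp by (rule LP_well_posed_imp_ediam_tendsto_0)
next
  let ?S = "approx_solutions C Q A M pstar ft gt"
  assume rhs: "SEP_solutions f g C Q A \<noteq> {} \<and> ((\<lambda>\<epsilon>. ediam (?S \<epsilon>)) \<longlongrightarrow> 0) (at_right 0)"
  then obtain s where s: "s \<in> SEP_solutions f g C Q A"
    by blast
  have "pstar \<in> M"
    using assms by simp
  then have sub: "t \<in> ?S \<epsilon>" if "t \<in> SEP_solutions f g C Q A" "\<epsilon> > 0" for t \<epsilon>
    using that assms(10,11)
    by (intro SEP_solutions_subset_approx_solutions[THEN subsetD]) auto
  note conv = ediam_tendsto_0_imp_tendsto[OF conjunct2[OF rhs]]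
  \<comment> \<open>Uniqueness: the constant sequence at a solution \<open>t\<close> lies in all
    approximate solution sets of positive tolerance, as does \<open>s\<close>. Hence it converges to
    \<open>s\<close>.\<close>
  have "t = s" if "t \<in> SEP_solutions f g C Q A" for t
  proof -
    have "(\<lambda>_::nat. t) \<longlonglongrightarrow> s"
      by (rule conv[OF _ LIMSEQ_inverse_real_of_nat]) (auto simp del: of_nat_Suc
        intro!: sub that s)
    then show ?thesis
      by (simp add: LIMSEQ_const_iff)
  qed
  with s have "SEP_solutions f g C Q A = {s}"
    by blast
  moreover have "z \<longlonglongrightarrow> s"
    if p: "\<forall>n. p n \<in> M" "p \<longlonglongrightarrow> pstar"
      and gas: "generalized_approximating_sequence ft gt C Q A p z" for p z
  proof -
    obtain \<delta> where \<delta>: "\<And>n. \<delta> n > 0" "\<delta> \<longlonglongrightarrow> 0" "\<And>n. z n \<in> ?S (\<delta> n)"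
      using generalized_approximating_sequence_imp_approx_solutions[OF _ p(2) gas] p(1) by metis
    then show ?thesis
      by (intro conv[of \<delta>] sub[OF s])
  qed
  ultimately show "LP_well_posed_by_perturbations f g C Q A M pstar ft gt"
    unfolding LP_well_posed_by_perturbations_def by blast
qed

end
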